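(* Let $F\in\mathcal{H}^d$ and $A=\mathcal{A}(F)$. Suppose that there exist $\mathbf{b}\in\Delta^d_{++}$, $\boldsymbol{\lambda}\in\mathbb{R}^d_{++}$ and $\mathbf{u}\in\mathcal{S}_{++}$ such that $A^T\mathbf{b}=\rho(A)\mathbf{b}$ and $F(\mathbf{u})=\boldsymbol{\lambda}\otimes\mathbf{u}$. Suppose that $\rho(A)\le1$, that $F$ is differentiable at $\mathbf{u}$, and that there exist $i\in[d]$ and $\tau\in\mathbb{N}$ such that $$\forall\mathbf{w}\in\mathcal{K}_+\setminus\{0\},\quad\text{if}\quad\mathbf{x}=\sum_{k=1}^\tau DF(\mathbf{u})^k\mathbf{w},\quad\text{then}\quad\mathbf{x}_i\in\mathbb{R}^{n_i}_{++}.$$ Then, for every $(\boldsymbol{\theta},\mathbf{v})\in\mathbb{R}^d_+\times(\mathcal{S}_+\setminus\mathcal{K}_{++})$ with $F(\mathbf{v})=\boldsymbol{\theta}\otimes\mathbf{v}$, we have $$\prod_{j=1}^d\theta_j^{b_j}<\prod_{j=1}^d\lambda_j^{b_j}.$$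
   Context: $\mathbb{N}=\{1,2,\ldots\}$, $[n]=\{1,\ldots,n\}$; $\rho$ is the spectral radius. Fix $d,n_1,\ldots,n_d\in\mathbb{N}$. Let $\mathcal{K}_+=\mathbb{R}^{n_1}_+\times\cdots\times\mathbb{R}^{n_d}_+$ (nonnegative entries), $\mathcal{K}_{++}=\mathbb{R}^{n_1}_{++}\times\cdots\times\mathbb{R}^{n_d}_{++}$ (positive entries), $\Delta^d_{++}=\{\mathbf{z}\in\mathbb{R}^d_{++}:\sum_i z_i=1\}$. Write $\mathbf{x}=(\mathbf{x}_1,\ldots,\mathbf{x}_d)$ with $\mathbf{x}_i\in\mathbb{R}^{n_i}$. $\mathbf{x}\le\mathbf{y}$ means $\mathbf{y}-\mathbf{x}\in\mathcal{K}_+$. For $\boldsymbol{\alpha}\in\mathbb{R}^d$, $\boldsymbol{\alpha}\otimes\mathbf{x}=(\alpha_1\mathbf{x}_1,\ldots,\alpha_d\mathbf{x}_d)$. For $\boldsymbol{\alpha}\in\mathbb{R}^d_{++}$ and $B\in\mathbb{R}^{d\times d}$, $\boldsymbol{\alpha}^B=(\prod_{k}\alpha_k^{B_{1,k}},\ldots,\prod_k\alpha_k^{B_{d,k}})$. $\mathbf{1}$ is the vector of all ones. $DF(\mathbf{u})$ is the Jacobian matrix of $F$ at $\mathbf{u}$ (of size $N\times N$, $N=n_1+\cdots+n_d$). $F\colon\mathcal{K}_+\to\mathcal{K}_+$ is order-preserving if $\mathbf{x}\le\mathbf{y}$ implies $F(\mathbf{x})\le F(\mathbf{y})$; it is multi-homogeneous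 with homogeneity matrix $\mathcal{A}(F)=A\in\mathbb{R}^{d\times d}$ if $F(\boldsymbol{\alpha}\otimes\mathbf{x})=\boldsymbol{\alpha}^A\otimes F(\mathbf{x})$ for all $\mathbf{x}\in\mathcal{K}_+$, $\boldsymbol{\alpha}\in\mathbb{R}^d_{++}$. $\mathcal{H}^d$ is the set of $F\colon\mathcal{K}_+\to\mathcal{K}_+$ that are continuous, order-preserving and multi-homogeneous, with $F(\mathbf{1})\in\mathcal{K}_{++}$ and such that $\mathcal{A}(F)$ has at least one nonzero entry per row. For each $i$, $\|\cdot\|_{\gamma_i}$ is a norm on $\mathbb{R}^{n_i}$, assumed monotonic ($0\le\mathbf{x}_i\le\mathbf{y}_i$ implies $\|\mathbf{x}_i\|_{\gamma_i}\le\|\mathbf{y}_i\|_{\gamma_i}$); $\mathcal{S}_+=\{\mathbf{x}\in\mathcal{K}_+:\|\mathbf{x}_i\|_{\gamma_i}=1\ \forall i\in[d]\}$ and $\mathcal{S}_{++}=\mathcal{S}_+\cap\mathcal{K}_{++}$. *)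

theory Defs
  imports "HOL-Analysis.Analysis"
begin

text \<open>
  Encoding of the product of Euclidean spaces with block dimensions \<open>n\<^sub>1, \<dots>, n\<^sub>d\<close>:
  the finite type \<open>'d\<close> indexes the blocks, the finite type \<open>'n\<close> indexes all
  \<open>N = n\<^sub>1 + \<dots> + n\<^sub>d\<close> coordinates, and a surjection \<open>blk :: 'n \<Rightarrow> 'd\<close> sends a coordinate to its
  block. So \<open>n\<^sub>i\<close> is the number of \<open>j\<close> with \<open>blk j = i\<close>, which is at least 1 by surjectivity, and
  \<open>(x\<^sub>1, \<dots>, x\<^sub>d)\<close> is a single vector in \<open>real ^ 'n\<close>. The coordinate space of block \<open>i\<close> is
  identified with the vectors vanishing outside block \<open>i\<close>.
\<close>

definition nonneg_cone :: "(real ^ 'k::finite) set" where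
  "nonneg_cone = {x. \<forall>j. 0 \<le> x $ j}"

definition pos_cone :: "(real ^ 'k::finite) set" where
  "pos_cone = {x. \<forall>j. 0 < x $ j}"

definition pos_simplex :: "(real ^ 'k::finite) set" where
  "pos_simplex = {z \<in> pos_cone. (\<Sum>i\<in>UNIV. z $ i) = 1}"

definition block_space :: "('n::finite \<Rightarrow> 'd::finite) \<Rightarrow> 'd \<Rightarrow> (real ^ 'n) set" where
  "block_space blk i = {x. \<forall>j. blk j \<noteq> i \<longrightarrow> x $ j = 0}"

definition block :: "('n::finite \<Rightarrow> 'd::finite) \<Rightarrow> 'd \<Rightarrow> real ^ 'n \<Rightarrow> real ^ 'n" where
  "block blk i x = (\<chi> j. if blk j = i then x $ j else 0)"

definition block_scale ::
    "('n::finite \<Rightarrow> 'd::finite) \<Rightarrow> real ^ 'd \<Rightarrow> real ^ 'n \<Rightarrow> real ^ 'n" where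
  "block_scale blk \<alpha> x = (\<chi> j. \<alpha> $ blk j * x $ j)"

definition vec_powr :: "real ^ 'd::finite \<Rightarrow> real ^ 'd ^ 'd \<Rightarrow> real ^ 'd" where
  "vec_powr \<alpha> B = (\<chi> i. \<Prod>k\<in>UNIV. \<alpha> $ k powr (B $ i $ k))"

definition multi_homogeneous ::
    "('n::finite \<Rightarrow> 'd::finite) \<Rightarrow> (real ^ 'n \<Rightarrow> real ^ 'n) \<Rightarrow> real ^ 'd ^ 'd \<Rightarrow> bool" where
  "multi_homogeneous blk F A \<longleftrightarrow>
     (\<forall>x \<in> nonneg_cone. \<forall>\<alpha> \<in> pos_cone.
        F (block_scale blk \<alpha> x) = block_scale blk (vec_powr \<alpha> A) (F x))"

text \<open>
  Only the values of \<open>F\<close> on the nonnegative cone matter. The order used by \<open>mono_on\<close> is the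
  componentwise one, and \<open>1\<close> is the vector of all ones. When \<open>F 1\<close> is positive the homogeneity
  matrix is unique (lemma \<open>homogeneity_matrix_unique\<close>), so the row condition is one on
  \<^emph>\<open>the\<close> homogeneity matrix.
\<close>

definition multi_hom_maps ::
    "('n::finite \<Rightarrow> 'd::finite) \<Rightarrow> (real ^ 'n \<Rightarrow> real ^ 'n) set" where
  "multi_hom_maps blk =
     {F. F ` nonneg_cone \<subseteq> nonneg_cone \<and>
         continuous_on nonneg_cone F \<and>
         mono_on nonneg_cone F \<and>
         F 1 \<in> pos_cone \<and>
         (\<exists>A. multi_homogeneous blk F A \<and> (\<forall>i. \<exists>j. A $ i $ j \<noteq> 0))}"

lemma homogeneity_matrix_unique:
  fixes blk :: "'n::finite \<Rightarrow> 'd::finite"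
  assumes "surj blk" "F 1 \<in> pos_cone" "multi_homogeneous blk F A" "multi_homogeneous blk F B"
  shows "A = B"
proof -
  have "A $ i $ j = B $ i $ j" for i j
  proof -
    obtain m where m: "blk m = i" using assms(1) by (metis surjD)
    define \<alpha> :: "real ^ 'd" where "\<alpha> = (\<chi> k. if k = j then 2 else 1)"
    have \<alpha>: "\<alpha> \<in> pos_cone" and one: "(1 :: real ^ 'n) \<in> nonneg_cone"
      by (auto simp: \<alpha>_def pos_cone_def nonneg_cone_def)
    have pw: "vec_powr \<alpha> C $ i = 2 powr (C $ i $ j)" for C
    proof -
      have "vec_powr \<alpha> C $ i = (\<Prod>k\<in>UNIV. if k = j then 2 powr (C $ i $ k) else 1)"
        by (simp add: vec_powr_def \<alpha>_def if_distrib[where f = "\<lambda>t. t powr _"] cong: if_cong)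
      then show ?thesis by simp
    qed
    have "block_scale blk (vec_powr \<alpha> A) (F 1) = block_scale blk (vec_powr \<alpha> B) (F 1)"
      using assms(3,4) \<alpha> one unfolding multi_homogeneous_def by metis
    then have "vec_powr \<alpha> A $ i * F 1 $ m = vec_powr \<alpha> B $ i * F 1 $ m"
      using m by (metis (no_types, lifting) block_scale_def vec_lambda_beta)
    moreover have "F 1 $ m > 0" using assms(2) by (auto simp: pos_cone_def)
    ultimately show ?thesis using powr_inj[of 2 "A $ i $ j" "B $ i $ j"] by (simp add: pw)
  qed
  then show ?thesis by (simp add: vec_eq_iff)
qed

definition norm_on :: "(real ^ 'n::finite) set \<Rightarrow> (real ^ 'n \<Rightarrow> real) \<Rightarrow> bool" where
  "norm_on V p \<longleftrightarrow>
     (\<forall>x\<in>V. 0 \<le> p x \<and> (p x = 0 \<longleftrightarrow> x = 0)) \<and>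
     (\<forall>x\<in>V. \<forall>c. p (c *\<^sub>R x) = \<bar>c\<bar> * p x) \<and>
     (\<forall>x\<in>V. \<forall>y\<in>V. p (x + y) \<le> p x + p y)"

definition monotonic_norm_on :: "(real ^ 'n::finite) set \<Rightarrow> (real ^ 'n \<Rightarrow> real) \<Rightarrow> bool" where
  "monotonic_norm_on V p \<longleftrightarrow>
     norm_on V p \<and> (\<forall>x\<in>V. \<forall>y\<in>V. 0 \<le> x \<and> x \<le> y \<longrightarrow> p x \<le> p y)"

definition unit_sphere_plus ::
    "('n::finite \<Rightarrow> 'd::finite) \<Rightarrow> ('d \<Rightarrow> real ^ 'n \<Rightarrow> real) \<Rightarrow> (real ^ 'n) set" where
  "unit_sphere_plus blk \<gamma> = {x \<in> nonneg_cone. \<forall>i. \<gamma> i (block blk i x) = 1}"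

text \<open>
  The spectral radius of a real square matrix: the largest modulus of its complex eigenvalues,
  which form a finite nonempty set.
\<close>

definition complex_eigenvalues :: "real ^ 'd::finite ^ 'd \<Rightarrow> complex set" where
  "complex_eigenvalues A =
     {\<mu>. \<exists>v :: complex ^ 'd. v \<noteq> 0 \<and> (\<chi> i j. complex_of_real (A $ i $ j)) *v v = \<mu> *s v}"

definition spectral_radius :: "real ^ 'd::finite ^ 'd \<Rightarrow> real" where
  "spectral_radius A = Max (cmod ` complex_eigenvalues A)"

text \<open>
  Matrix powers are defined here because the library's \<open>^\<close> on vectors of vectors is the
  entrywise power.
\<close>

primrec matrix_power :: "real ^ 'n::finite ^ 'n \<Rightarrow> nat \<Rightarrow> real ^ 'n ^ 'n" where
  "matrix_power M 0 = mat 1"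
| "matrix_power M (Suc k) = M ** matrix_power M k"

end

theory Submission
  imports Defs
begin

text \<open>
  Suppose that \<open>F v = \<theta> \<otimes> v\<close> with all \<open>\<theta>\<^sub>i > 0\<close> (otherwise the left-hand product is \<open>0\<close>), and let
  \<open>t\<^sub>i\<close> be the least number with \<open>v \<le> t \<otimes> u\<close>. Since \<open>u\<close> and \<open>v\<close> have the same block norms and the
  norms are monotonic, \<open>t\<^sub>i \<ge> 1\<close> (lemma \<open>tight_block_dominator\<close>). Applying \<open>F\<close> to \<open>v \<le> t \<otimes> u\<close>
  and reading the result at a coordinate where the two sides touch gives
  \<open>\<theta>\<^sub>i t\<^sub>i \<le> (t\<^sup>A)\<^sub>i \<lambda>\<^sub>i\<close>. In the product of these inequalities with weights \<open>b\<^sub>i\<close>, the left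
  eigenvector relation turns the factor \<open>t\<^sup>A\<close> into \<open>(\<Prod>\<^sub>k t\<^sub>k powr b\<^sub>k) powr \<rho>(A)\<close>, which is at
  most \<open>\<Prod>\<^sub>k t\<^sub>k powr b\<^sub>k\<close> because \<open>\<rho>(A) \<le> 1\<close> and \<open>t \<ge> 1\<close>. This is the weak inequality, and
  if it is not strict, then \<open>\<theta>\<^sub>i t\<^sub>i = (t\<^sup>A)\<^sub>i \<lambda>\<^sub>i\<close> for every \<open>i\<close> (lemma \<open>weighted_log_equality\<close>).

  In that case \<open>z = t\<^sup>-\<^sup>1 \<otimes> v\<close> satisfies \<open>z \<le> u\<close> and \<open>F z = \<lambda> \<otimes> z\<close>, and every block has a
  coordinate in the contact set \<open>T = {j. z\<^sub>j = u\<^sub>j}\<close>. For \<open>j \<in> T\<close> the values \<open>F(z)\<^sub>j\<close> and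
  \<open>F(u)\<^sub>j\<close> agree, so by monotonicity \<open>F\<^sub>j\<close> is constant on the whole order interval \<open>[z, u]\<close>.
  Hence its derivative at \<open>u\<close> vanishes in all coordinate directions outside \<open>T\<close>: the Jacobian maps
  vectors vanishing on \<open>T\<close> to vectors vanishing on \<open>T\<close>, and so do its powers (lemma
  \<open>matrix_power_jacobian_zero_on_contact\<close>). Applied to the vector \<open>u - z\<close>, which is nonzero as \<open>v\<close>
  has a zero coordinate, this contradicts the assumption that the sum of the powers makes some
  entire block positive.
\<close>

section \<open>Comparing vectors of equal block norms\<close>

text \<open>
  The least block factors with \<open>v \<le> t \<otimes> u\<close> are the maxima of \<open>v\<^sub>j / u\<^sub>j\<close> over the blocks, so each
  is attained. None is below \<open>1\<close>: monotonicity gives \<open>1 = \<parallel>v\<^sub>i\<parallel> \<le> t\<^sub>i \<parallel>u\<^sub>i\<parallel> = t\<^sub>i\<close>.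
\<close>

lemma tight_block_dominator:
  fixes blk :: "'n::finite \<Rightarrow> 'd::finite" and u v :: "real ^ 'n"
  assumes surj: "surj blk"
    and norm: "\<And>i. monotonic_norm_on (block_space blk i) (\<gamma> i)"
    and u: "u \<in> unit_sphere_plus blk \<gamma> \<inter> pos_cone"
    and v: "v \<in> unit_sphere_plus blk \<gamma>"
  obtains t :: "real ^ 'd" where "\<And>i. t $ i \<ge> 1" "v \<le> block_scale blk t u"
    "\<And>i. \<exists>j. blk j = i \<and> v $ j = t $ i * u $ j"
proof -
  define t :: "real ^ 'd" where "t = (\<chi> i. Max ((\<lambda>j. v $ j / u $ j) ` {j. blk j = i}))"
  have upos: "u $ j > 0" for j using u by (auto simp: pos_cone_def)
  have vnn: "v $ j \<ge> 0" for j using v by (auto simp: unit_sphere_plus_def nonneg_cone_def)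
  have ne: "{j. blk j = i} \<noteq> {}" for i using surj by (metis (mono_tags) Collect_empty_eq surjD)
  have "t $ i \<in> (\<lambda>j. v $ j / u $ j) ` {j. blk j = i}" for i
    unfolding t_def vec_lambda_beta by (rule Max_in) (use ne in auto)
  then have touch: "\<exists>j. blk j = i \<and> v $ j = t $ i * u $ j" for i
    using upos by (force simp: field_simps less_imp_neq[symmetric] image_iff)
  have ratio_le: "v $ j / u $ j \<le> t $ blk j" for j
    unfolding t_def vec_lambda_beta by (rule Max_ge) auto
  have dom: "v $ j \<le> t $ blk j * u $ j" for j
    using ratio_le[of j] upos[of j] by (simp add: pos_divide_le_eq)
  have "t $ i \<ge> 1" for i
  proof -
    have tnn: "t $ i \<ge> 0"
      using touch[of i] upos vnn by (metis less_le_not_le mult_neg_pos not_le)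
    have "block blk i v \<le> t $ i *\<^sub>R block blk i u" and "0 \<le> block blk i v"
      using dom vnn by (auto simp: less_eq_vec_def block_def)
    moreover have mem: "block blk i x \<in> block_space blk i" "c *\<^sub>R block blk i x \<in> block_space blk i"
      for x c by (auto simp: block_def block_space_def)
    ultimately have "\<gamma> i (block blk i v) \<le> \<gamma> i (t $ i *\<^sub>R block blk i u)"
      using norm[of i] unfolding monotonic_norm_on_def by blast
    also have "\<dots> = t $ i * \<gamma> i (block blk i u)"
      using norm[of i] mem tnn unfolding monotonic_norm_on_def norm_on_def by simp
    finally show ?thesis using u v by (simp add: unit_sphere_plus_def)
  qed
  moreover have "v \<le> block_scale blk t u" using dom by (simp add: less_eq_vec_def block_scale_def)
  ultimately show ?thesis using touch that by blast
qed

section \<open>The weighted product inequality\<close>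

lemma prod_powr_eq_exp:
  fixes x b :: "'k::finite \<Rightarrow> real"
  assumes "\<And>i. x i > 0"
  shows "(\<Prod>i\<in>UNIV. x i powr b i) = exp (\<Sum>i\<in>UNIV. b i * ln (x i))"
  using assms by (simp add: powr_def exp_sum less_imp_neq[symmetric])

text \<open>
  In logarithmic coordinates \<open>s = ln t\<close> the termwise inequalities \<open>\<theta> t \<le> t\<^sup>A \<lambda>\<close> are affine.
  Pairing them with \<open>b\<close> replaces \<open>A s\<close> by \<open>r (b \<bullet> s)\<close>, which is at most \<open>b \<bullet> s\<close>. As all weights are
  positive, one strict inequality among them would make the paired inequality strict.
\<close>

lemma weighted_log_equality:
  fixes A :: "real ^ 'd::finite ^ 'd" and b p q s :: "real ^ 'd"
  assumes b: "\<And>i. b $ i > 0" and eig: "transpose A *v b = r *\<^sub>R b" and r: "r \<le> 1"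
    and s: "\<And>i. s $ i \<ge> 0"
    and le: "\<And>i. p $ i + s $ i \<le> (A *v s) $ i + q $ i"
    and ge: "(\<Sum>i\<in>UNIV. b $ i * q $ i) \<le> (\<Sum>i\<in>UNIV. b $ i * p $ i)"
  shows "p $ i + s $ i = (A *v s) $ i + q $ i"
proof (rule ccontr)
  assume "p $ i + s $ i \<noteq> (A *v s) $ i + q $ i"
  then have "p $ i + s $ i < (A *v s) $ i + q $ i" using le[of i] by simp
  then have "(\<Sum>i\<in>UNIV. b $ i * (p $ i + s $ i)) < (\<Sum>i\<in>UNIV. b $ i * ((A *v s) $ i + q $ i))"
    using b le by (intro sum_strict_mono_ex1) (auto intro: mult_left_mono less_imp_le)
  moreover have "(\<Sum>i\<in>UNIV. b $ i * (A *v s) $ i) = r * (\<Sum>i\<in>UNIV. b $ i * s $ i)"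
  proof -
    have "(\<Sum>i\<in>UNIV. b $ i * (A *v s) $ i) = b \<bullet> (A *v s)" by (simp add: inner_vec_def)
    also have "\<dots> = (transpose A *v b) \<bullet> s" by (simp add: dot_lmul_matrix)
    also have "\<dots> = r * (\<Sum>i\<in>UNIV. b $ i * s $ i)" unfolding eig by (simp add: inner_vec_def sum_distrib_left mult.assoc)
    finally show ?thesis .
  qed
  moreover have "r * (\<Sum>i\<in>UNIV. b $ i * s $ i) \<le> (\<Sum>i\<in>UNIV. b $ i * s $ i)"
  proof -
    have "(\<Sum>i\<in>UNIV. b $ i * s $ i) \<ge> 0" using b s by (intro sum_nonneg) (simp add: less_imp_le)
    then show ?thesis using mult_right_mono[OF r] by fastforce
  qed
  ultimately show False using ge by (simp add: distrib_left sum.distrib)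
qed

section \<open>The Jacobian at a point of contact\<close>

text \<open>
  A coordinate of a monotone map that takes the same value at both ends of \<open>[z, u]\<close> is constant on
  the interval, in particular on the segment from \<open>u\<close> in any direction \<open>-e\<^sub>m\<close> with \<open>z\<^sub>m < u\<^sub>m\<close>.
\<close>

lemma jacobian_entry_zero_on_contact:
  fixes F :: "real ^ 'n::finite \<Rightarrow> real ^ 'n"
  assumes mono: "mono_on nonneg_cone F" and z: "z \<in> nonneg_cone" and le: "z \<le> u"
    and diff: "F differentiable (at u)"
    and j: "F z $ j = F u $ j" and m: "z $ m < u $ m"
  shows "jacobian F (at u) $ j $ m = 0"
proof -
  define h where "h = u $ m - z $ m"
  define \<phi> where "\<phi> \<epsilon> = u - \<epsilon> *\<^sub>R axis m 1" for \<epsilon> :: real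
  have const: "F (\<phi> \<epsilon>) $ j = F u $ j" if "0 \<le> \<epsilon>" "\<epsilon> \<le> h" for \<epsilon>
  proof -
    have zle: "z \<le> \<phi> \<epsilon>" and leu: "\<phi> \<epsilon> \<le> u"
      using le that by (auto simp: less_eq_vec_def \<phi>_def h_def axis_def)
    have mem: "\<phi> \<epsilon> \<in> nonneg_cone" "u \<in> nonneg_cone"
      using zle le z by (auto simp: nonneg_cone_def less_eq_vec_def intro: order_trans)
    have "F z \<le> F (\<phi> \<epsilon>)" "F (\<phi> \<epsilon>) \<le> F u"
      using mono z mem zle leu by (auto intro: mono_onD)
    then show ?thesis using j by (metis antisym less_eq_vec_def)
  qed
  have "(F has_derivative (\<lambda>x. jacobian F (at u) *v x)) (at (\<phi> 0))"
    using diff jacobian_works by (simp add: \<phi>_def) blast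
  then have "((\<lambda>\<epsilon>. F (\<phi> \<epsilon>)) has_derivative (\<lambda>\<epsilon>. jacobian F (at u) *v (- (\<epsilon> *\<^sub>R axis m 1))))
      (at 0 within {0..h})"
    by (rule has_derivative_compose[rotated]) (auto simp: \<phi>_def intro!: derivative_eq_intros)
  then have "((\<lambda>\<epsilon>. F (\<phi> \<epsilon>) $ j) has_derivative (\<lambda>\<epsilon>. (jacobian F (at u) *v (- (\<epsilon> *\<^sub>R axis m 1))) $ j))
      (at 0 within {0..h})"
    by (rule bounded_linear.has_derivative[OF bounded_linear_vec_nth])
  moreover have "(jacobian F (at u) *v (- (\<epsilon> *\<^sub>R axis m 1))) $ j = - jacobian F (at u) $ j $ m * \<epsilon>"
    for \<epsilon> :: real
    by (simp add: matrix_vector_mult_def axis_def if_distrib if_distribR sum_negf cong: if_cong)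
  ultimately have "((\<lambda>\<epsilon>. F (\<phi> \<epsilon>) $ j) has_real_derivative - jacobian F (at u) $ j $ m)
      (at 0 within {0..h})"
    by (simp only: has_field_derivative_def)
  moreover have "((\<lambda>\<epsilon>. F (\<phi> \<epsilon>) $ j) has_real_derivative 0) (at 0 within {0..h})"
    by (rule has_field_derivative_transform_within[where d = 1 and f = "\<lambda>_. F u $ j"])
       (use m const in \<open>auto simp: h_def\<close>)
  moreover have "at 0 within {0..h} \<noteq> bot"
    using m by (simp add: trivial_limit_within islimpt_Icc h_def)
  ultimately show ?thesis using has_field_derivative_unique by fastforce
qed

text \<open>
  If every coordinate in the contact set \<open>{j. z\<^sub>j = u\<^sub>j}\<close> satisfies the hypothesis of the previous
  lemma, then the Jacobian has no entry from outside the contact set into it, so the vectors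
  supported off the contact set, such as \<open>u - z\<close>, form an invariant subspace.
\<close>

lemma matrix_power_jacobian_zero_on_contact:
  fixes F :: "real ^ 'n::finite \<Rightarrow> real ^ 'n"
  assumes mono: "mono_on nonneg_cone F" and z: "z \<in> nonneg_cone" and le: "z \<le> u"
    and diff: "F differentiable (at u)"
    and contact: "\<And>j. z $ j = u $ j \<Longrightarrow> F z $ j = F u $ j"
    and "z $ j = u $ j"
  shows "(matrix_power (jacobian F (at u)) k *v (u - z)) $ j = 0"
  using \<open>z $ j = u $ j\<close>
proof (induction k arbitrary: j)
  case (Suc k)
  let ?J = "jacobian F (at u)" and ?w = "matrix_power (jacobian F (at u)) k *v (u - z)"
  have "?J $ j $ m * ?w $ m = 0" for m
  proof (cases "z $ m = u $ m")
    case False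
    then have "z $ m < u $ m" using le by (simp add: less_eq_vec_def order_less_le)
    then show ?thesis
      using jacobian_entry_zero_on_contact[OF mono z le diff contact[OF Suc.prems]] by simp
  qed (use Suc.IH in simp)
  then have "(?J *v ?w) $ j = 0"
    unfolding matrix_vector_mult_def[of ?J] vec_lambda_beta by (simp add: sum.neutral)
  then show ?case by (simp add: matrix_vector_mul_assoc)
qed simp

section \<open>Comparison with eigenvectors on the boundary\<close>

theorem theorem4p3:
  fixes blk :: "'n::finite \<Rightarrow> 'd::finite"
    and \<gamma> :: "'d \<Rightarrow> real ^ 'n \<Rightarrow> real"
    and F :: "real ^ 'n \<Rightarrow> real ^ 'n"
    and A :: "real ^ 'd ^ 'd"
    and b lam :: "real ^ 'd"
    and u :: "real ^ 'n"
  assumes "surj blk"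
    and "\<And>i. monotonic_norm_on (block_space blk i) (\<gamma> i)"
    and "F \<in> multi_hom_maps blk"
    and "multi_homogeneous blk F A"
    and "b \<in> pos_simplex"
    and "lam \<in> pos_cone"
    and "u \<in> unit_sphere_plus blk \<gamma> \<inter> pos_cone"
    and "transpose A *v b = spectral_radius A *\<^sub>R b"
    and "F u = block_scale blk lam u"
    and "spectral_radius A \<le> 1"
    and "F differentiable (at u)"
    and "\<exists>i. \<exists>\<tau>::nat. \<tau> \<ge> 1 \<and>
           (\<forall>w \<in> nonneg_cone - {0}. \<forall>x.
              x = (\<Sum>k=1..\<tau>. matrix_power (jacobian F (at u)) k *v w) \<longrightarrow>
              (\<forall>j. blk j = i \<longrightarrow> x $ j > 0))"
  shows "\<forall>\<theta> \<in> nonneg_cone. \<forall>v \<in> unit_sphere_plus blk \<gamma> - pos_cone.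
           F v = block_scale blk \<theta> v \<longrightarrow>
           (\<Prod>j\<in>UNIV. \<theta> $ j powr (b $ j)) < (\<Prod>j\<in>UNIV. lam $ j powr (b $ j))"
proof (intro ballI impI)
  fix \<theta> :: "real ^ 'd" and v :: "real ^ 'n"
  assume \<theta>: "\<theta> \<in> nonneg_cone" and v: "v \<in> unit_sphere_plus blk \<gamma> - pos_cone"
    and Fv: "F v = block_scale blk \<theta> v"
  have mono: "mono_on nonneg_cone F" using assms(3) by (simp add: multi_hom_maps_def)
  have b: "b $ i > 0" for i using assms(5) by (auto simp: pos_simplex_def pos_cone_def)
  have lam: "lam $ i > 0" for i using assms(6) by (auto simp: pos_cone_def)
  have u: "u $ j > 0" for j using assms(7) by (auto simp: pos_cone_def)
  have unn: "u \<in> nonneg_cone" using u by (auto simp: nonneg_cone_def less_imp_le)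
  have vnn: "v \<in> nonneg_cone" using v by (auto simp: unit_sphere_plus_def)
  show "(\<Prod>j\<in>UNIV. \<theta> $ j powr (b $ j)) < (\<Prod>j\<in>UNIV. lam $ j powr (b $ j))"
  proof (cases "\<exists>i. \<theta> $ i = 0")
    case True
    then have "(\<Prod>j\<in>UNIV. \<theta> $ j powr (b $ j)) = 0" by auto
    moreover have "(\<Prod>j\<in>UNIV. lam $ j powr (b $ j)) > 0"
      using lam by (intro prod_pos) (simp add: less_imp_neq[symmetric])
    ultimately show ?thesis by (simp only:)
  next
    case False
    then have \<theta>pos: "\<theta> $ i > 0" for i
      using \<theta> by (auto simp: nonneg_cone_def order_less_le)
    obtain t :: "real ^ 'd" where t1: "\<And>i. t $ i \<ge> 1" and dom: "v \<le> block_scale blk t u"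
      and touch: "\<And>i. \<exists>j. blk j = i \<and> v $ j = t $ i * u $ j"
      using tight_block_dominator[OF assms(1,2,7)] v by blast
    have t: "t $ i > 0" for i using t1[of i] by simp
    have tpos: "t \<in> pos_cone" using t by (simp add: pos_cone_def)
    have tA: "vec_powr t A $ i = exp ((A *v (\<chi> k. ln (t $ k))) $ i)" for i
      using t by (simp add: vec_powr_def prod_powr_eq_exp matrix_vector_mult_def)
    have tApos: "vec_powr t A $ i > 0" for i by (simp add: tA)
    have ineq: "\<theta> $ i * t $ i \<le> vec_powr t A $ i * lam $ i" for i
    proof -
      obtain j where j: "blk j = i" "v $ j = t $ i * u $ j" using touch by blast
      have "block_scale blk t u \<in> nonneg_cone"
        using t u by (simp add: nonneg_cone_def block_scale_def less_imp_le)
      then have "F v \<le> F (block_scale blk t u)" using mono vnn dom by (auto intro: mono_onD)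
      also have "\<dots> = block_scale blk (vec_powr t A) (F u)"
        using assms(4) unn tpos by (simp add: multi_homogeneous_def)
      finally have "F v $ j \<le> block_scale blk (vec_powr t A) (F u) $ j"
        by (simp add: less_eq_vec_def)
      then have "(\<theta> $ i * t $ i) * u $ j \<le> (vec_powr t A $ i * lam $ i) * u $ j"
        using j by (simp add: Fv assms(9) block_scale_def mult.assoc)
      then show ?thesis using u[of j] by simp
    qed
    show ?thesis
    proof (rule ccontr)
      assume "\<not> ?thesis"
      \<comment> \<open>The weak inequality always holds, so its failure to be strict is the equality case.\<close>
      then have ge: "(\<Sum>i\<in>UNIV. b $ i * ln (lam $ i)) \<le> (\<Sum>i\<in>UNIV. b $ i * ln (\<theta> $ i))"
        using lam \<theta>pos by (simp add: prod_powr_eq_exp)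
      have log_ineq: "ln (\<theta> $ i) + ln (t $ i) \<le> (A *v (\<chi> k. ln (t $ k))) $ i + ln (lam $ i)" for i
      proof -
        have "ln (\<theta> $ i * t $ i) \<le> ln (vec_powr t A $ i * lam $ i)"
          using ineq[of i] \<theta>pos[of i] t[of i] by (intro ln_mono) auto
        then show ?thesis using \<theta>pos[of i] t[of i] lam[of i] by (simp add: ln_mult tA)
      qed
      have eq: "\<theta> $ i * t $ i = vec_powr t A $ i * lam $ i" for i
      proof -
        have "ln (\<theta> $ i) + ln (t $ i) = (A *v (\<chi> k. ln (t $ k))) $ i + ln (lam $ i)"
          using weighted_log_equality[OF b assms(8,10),
              of "\<chi> k. ln (t $ k)" "\<chi> k. ln (\<theta> $ k)" "\<chi> k. ln (lam $ k)" i]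
            log_ineq ge t1 by simp
        then have "exp (ln (\<theta> $ i) + ln (t $ i)) = exp ((A *v (\<chi> k. ln (t $ k))) $ i + ln (lam $ i))"
          by simp
        then show ?thesis using \<theta>pos[of i] t[of i] lam[of i] by (simp add: exp_add tA)
      qed
      \<comment> \<open>Dividing out \<open>t\<close> turns \<open>v\<close> into a vector below \<open>u\<close> with the same factors \<open>\<lambda>\<close>.\<close>
      define z where "z = (\<chi> j. v $ j / t $ blk j)"
      have znn: "z \<in> nonneg_cone" using vnn t by (simp add: z_def nonneg_cone_def less_imp_le)
      have zu: "z \<le> u"
        using dom t by (simp add: z_def less_eq_vec_def block_scale_def pos_divide_le_eq mult.commute)
      have contact: "F z $ j = F u $ j" if "z $ j = u $ j" for j
      proof -
        have vj: "v $ j = t $ blk j * u $ j" using that t[of "blk j"] by (simp add: z_def field_simps)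
        have "v = block_scale blk t z"
          using t by (simp add: z_def block_scale_def vec_eq_iff less_imp_neq[symmetric])
        then have "F v = block_scale blk (vec_powr t A) (F z)"
          using assms(4) znn tpos by (simp add: multi_homogeneous_def)
        then have "vec_powr t A $ blk j * F z $ j = \<theta> $ blk j * v $ j"
          using Fv by (simp add: block_scale_def vec_eq_iff)
        also have "\<dots> = (\<theta> $ blk j * t $ blk j) * u $ j" by (simp add: vj)
        also have "\<dots> = vec_powr t A $ blk j * F u $ j" by (simp add: eq assms(9) block_scale_def)
        finally show ?thesis using tApos[of "blk j"] by simp
      qed
      have "u - z \<in> nonneg_cone - {0}"
      proof -
        obtain j where "v $ j \<le> 0" using v by (auto simp: pos_cone_def not_less)
        then have "z $ j \<le> 0" using t[of "blk j"] by (simp add: z_def divide_le_0_iff)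
        then have "z \<noteq> u" using u[of j] by auto
        then show ?thesis using zu by (simp add: nonneg_cone_def less_eq_vec_def)
      qed
      then obtain i \<tau> where pos: "\<And>j. blk j = i \<Longrightarrow>
          (\<Sum>k=1..\<tau>. matrix_power (jacobian F (at u)) k *v (u - z)) $ j > 0"
        using assms(12) by blast
      obtain j where j: "blk j = i" "v $ j = t $ i * u $ j" using touch by blast
      then have "z $ j = u $ j" using t[of i] by (simp add: z_def)
      then have "(\<Sum>k=1..\<tau>. matrix_power (jacobian F (at u)) k *v (u - z)) $ j = 0"
        using matrix_power_jacobian_zero_on_contact[OF mono znn zu assms(11) contact] by simp
      then show False using pos[OF j(1)] by simp
    qed
  qed
qed

end
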